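(* Let $X$ be a Fréchet space, $Y$ a separable Fréchet space and $T_n:X\to Y$, $n\in\mathbb{N}$, continuous linear mappings. Suppose that there are a dense subset $Y_0$ of $Y$ and mappings $S_n:Y_0\to X$, $n\in\mathbb{N}$, such that: (1) $\sum_{n=1}^{k-1}T_kS_{k-n}y$ converges unconditionally in $Y$, uniformly in $k\in\mathbb{N}$, for all $y\in Y_0$; (2) $\sum_{n=1}^{+\infty}T_kS_{k+n}y$ converges unconditionally in $Y$, uniformly in $k\in\mathbb{N}$, for all $y\in Y_0$; (3) $\sum_{n=1}^{+\infty}S_ny$ converges unconditionally in $X$, for all $y\in Y_0$; (4) $T_nS_ny\to y$ as $n\to+\infty$, for all $y\in Y_0$. Then the sequence $(T_n)$ is $B_1$-frequently universal.
   Context: $\mathbb{N}$ denotes the set of positive integers. Given a non-negative sequence $(\alpha_k)_{k\ge1}$ with $\sum_k\alpha_k=+\infty$, the associated admissible matrix is $A=(\alpha_{n,k})$ with $\alpha_{n,k}=\alpha_k/\sum_{j=1}^n\alpha_j$ for $1\le k\le n$ and $\alpha_{n,k}=0$ for $k>n$. The lower $A$-density of $E\subset\mathbb{N}$ is $\underline{d}_A(E)=\liminf_{n\to\infty}\sum_{k=1}^{+\infty}\alpha_{n,k}\mathbf{1}_E(k)$. A sequence $(T_n)$ of continuous linear maps $T_n:X\to Y$ is $A$-frequently universal if there exists $x\in X$ such that for every non-empty open set $U\subset Y$ the set $N(x,U)=\{n\in\mathbb{N}:T_nx\in U\}$ satisfies $\underline{d}_A(N(x,U))>0$. $B_1$ is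 the admissible matrix given by the coefficients $\alpha_k=e^{k/\log(k)}$ for $k$ large enough (the finitely many remaining coefficients are arbitrary positive numbers and do not affect the density). Unconditional convergence uniformly in $k$: series $\sum_n y_{n,k}$ ($k\in\mathbb{N}$; terms not present in a finite sum are taken to be $0$) converge unconditionally in $Y$, uniformly in $k\in\mathbb{N}$, if for each $k$ the series converges unconditionally and for every neighbourhood $W$ of $0$ in $Y$ there is $N\ge1$ such that $\sum_{n\in F}y_{n,k}\in W$ for every $k\in\mathbb{N}$ and every finite set $F\subset\{N,N+1,\dots\}$. *)

theory Defs
  imports "HOL-Analysis.Analysis"
begin

text \<open>
  The set of positive integers is rendered as \<open>{1..}\<close> inside \<^typ>\<open>nat\<close>;
  the value of a sequence at index 0 is never used.
\<close>

text \<open>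
  A Frechet space is a locally convex topological vector space whose topology is induced by
  a complete translation-invariant metric. Scalars are real; a complex Frechet space
  is covered by restriction of scalars, under which complex linear maps are real linear.
\<close>

class frechet_space = real_vector + topological_ab_group_add + complete_space +
  assumes dist_translation: "dist (x + z) (y + z) = dist x y"
    and tendsto_scaleR_Pair:
      "((\<lambda>p. fst p *\<^sub>R snd p) \<longlongrightarrow> a *\<^sub>R x) (nhds (a::real) \<times>\<^sub>F nhds x)"
    and locally_convex:
      "open U \<Longrightarrow> 0 \<in> U \<Longrightarrow>
         \<exists>V. open V \<and>
             (\<forall>x\<in>V. \<forall>y\<in>V. \<forall>u\<ge>0. \<forall>v\<ge>0. u + v = 1 \<longrightarrow> u *\<^sub>R x + v *\<^sub>R y \<in> V) \<and>
             0 \<in> V \<and> V \<subseteq> U"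

lemma frechet_locally_convex:
  fixes U :: "'a::frechet_space set"
  assumes "open U" "0 \<in> U"
  obtains V where "open V" "convex V" "0 \<in> V" "V \<subseteq> U"
  using locally_convex[OF assms] unfolding convex_def by blast

instance banach \<subseteq> frechet_space
proof
  fix x y z :: 'a and a :: real and U :: "'a set"
  show "dist (x + z) (y + z) = dist x y"
    by simp
  show "((\<lambda>p. fst p *\<^sub>R snd p) \<longlongrightarrow> a *\<^sub>R x) (nhds a \<times>\<^sub>F nhds x)"
    by (intro tendsto_scaleR filterlim_fst filterlim_snd)
  show "\<exists>V. open V \<and>
             (\<forall>x\<in>V. \<forall>y\<in>V. \<forall>u\<ge>0. \<forall>v\<ge>0. u + v = 1 \<longrightarrow> u *\<^sub>R x + v *\<^sub>R y \<in> V) \<and>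
             0 \<in> V \<and> V \<subseteq> U" if "open U" "0 \<in> U"
    using that unfolding convex_def[symmetric]
    by (metis open_contains_ball open_ball convex_ball centre_in_ball)
qed

text \<open>
  For a family \<open>y n k\<close>, the series over \<open>n \<ge> 1\<close> converge unconditionally, uniformly in
  \<open>k \<ge> 1\<close>. Unconditional convergence of one series is \<^const>\<open>summable_on\<close>.
\<close>

definition unif_uncond_convergent ::
    "(nat \<Rightarrow> nat \<Rightarrow> 'a::{comm_monoid_add, topological_space}) \<Rightarrow> bool" where
  "unif_uncond_convergent y \<longleftrightarrow>
     (\<forall>k\<ge>1. (\<lambda>n. y n k) summable_on {1..}) \<and>
     (\<forall>W. open W \<and> 0 \<in> W \<longrightarrow>
        (\<exists>N\<ge>1. \<forall>k\<ge>1. \<forall>F. finite F \<and> F \<subseteq> {N..} \<longrightarrow> (\<Sum>n\<in>F. y n k) \<in> W))"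

definition admissible_weights :: "(nat \<Rightarrow> real) \<Rightarrow> bool" where
  "admissible_weights \<alpha> \<longleftrightarrow>
     (\<forall>k\<ge>1. 0 \<le> \<alpha> k) \<and> filterlim (\<lambda>n. \<Sum>k=1..n. \<alpha> k) at_top sequentially"

text \<open>
  If the first weights vanish then the first rows are zero (as \<open>x / 0 = 0\<close>), which is
  irrelevant for the density below.
\<close>

definition admissible_matrix :: "(nat \<Rightarrow> real) \<Rightarrow> nat \<Rightarrow> nat \<Rightarrow> real" where
  "admissible_matrix \<alpha> n k = (if 1 \<le> k \<and> k \<le> n then \<alpha> k / (\<Sum>j=1..n. \<alpha> j) else 0)"

definition lower_density :: "(nat \<Rightarrow> nat \<Rightarrow> real) \<Rightarrow> nat set \<Rightarrow> ereal" where
  "lower_density A E = liminf (\<lambda>n. ereal (\<Sum>\<^sub>\<infinity>k\<in>{1..}. A n k * indicator E k))"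

definition visit_times :: "(nat \<Rightarrow> 'a \<Rightarrow> 'b) \<Rightarrow> 'a \<Rightarrow> 'b set \<Rightarrow> nat set" where
  "visit_times T x U = {n. 1 \<le> n \<and> T n x \<in> U}"

definition frequently_universal ::
    "(nat \<Rightarrow> nat \<Rightarrow> real) \<Rightarrow> (nat \<Rightarrow> 'a \<Rightarrow> 'b::topological_space) \<Rightarrow> bool" where
  "frequently_universal A T \<longleftrightarrow>
     (\<exists>x. \<forall>U. open U \<and> U \<noteq> {} \<longrightarrow> lower_density A (visit_times T x U) > 0)"

text \<open>
  The weights defining \<open>B\<^sub>1\<close> are prescribed only for large indices; the finitely many
  remaining ones are arbitrary positive numbers.
\<close>

definition B1_weights :: "(nat \<Rightarrow> real) \<Rightarrow> bool" where
  "B1_weights \<alpha> \<longleftrightarrow>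
     (\<forall>k\<ge>1. 0 < \<alpha> k) \<and> (\<forall>\<^sub>F k in sequentially. \<alpha> k = exp (real k / ln (real k)))"

lemma B1_weights_admissible:
  assumes "B1_weights \<alpha>"
  shows "admissible_weights \<alpha>"
proof -
  have pos: "0 < \<alpha> k" if "k \<ge> 1" for k
    using assms that by (auto simp: B1_weights_def)
  obtain K where K: "\<And>k. k \<ge> K \<Longrightarrow> \<alpha> k = exp (real k / ln (real k))"
    using assms by (auto simp: B1_weights_def eventually_sequentially)
  define M where "M = max 1 K"
  have ge1: "1 \<le> \<alpha> k" if "k \<ge> M" for k
    using that K[of k] by (auto simp: M_def)
  have lower: "real n - real M \<le> (\<Sum>k=1..n. \<alpha> k)" for n
  proof -
    have "real n - real M \<le> (\<Sum>k\<in>{Suc M..n}. 1)"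
      by simp
    also have "\<dots> \<le> (\<Sum>k\<in>{Suc M..n}. \<alpha> k)"
      by (intro sum_mono ge1) auto
    also have "\<dots> \<le> (\<Sum>k=1..n. \<alpha> k)"
      by (intro sum_mono2) (auto intro: less_imp_le[OF pos])
    finally show ?thesis .
  qed
  have "filterlim (\<lambda>n. - real M + real n) at_top sequentially"
    by (intro filterlim_tendsto_add_at_top[OF tendsto_const] filterlim_real_sequentially)
  then have "filterlim (\<lambda>n. \<Sum>k=1..n. \<alpha> k) at_top sequentially"
    by (rule filterlim_at_top_mono) (use lower in \<open>auto simp: algebra_simps\<close>)
  then show ?thesis
    using pos by (auto simp: admissible_weights_def less_imp_le)
qed

end

theory Submission
  imports Defs "HOL-Library.Discrete_Functions" "HOL-Library.Nat_Bijection"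
begin

text \<open>
  The universal vector is built as in the classical frequent hypercyclicity criterion. List
  targets \<open>y p\<close>, dense in \<open>Y\<close>, and let \<open>N p\<close> be a threshold beyond which the tails in
  hypotheses (1) to (3) for \<open>y 0, \<dots>, y p\<close>, and the error in (4) for \<open>y p\<close>, are at most \<open>(1/2) ^ p\<close>. Suppose that \<open>E p\<close> are disjoint sets of integers such
  that any two distinct elements \<open>n \<in> E p\<close> and \<open>m \<in> E q\<close> are at distance at least \<open>N p\<close> and
  \<open>N q\<close>. Then \<open>x = (\<Sum>p. \<Sum>m\<in>E p. S m (y p))\<close> converges, and for \<open>n \<in> E p\<close> the vector \<open>T n x\<close> is
  \<open>T n (S n (y p))\<close>, hence nearly \<open>y p\<close>, plus terms with \<open>\<bar>n - m\<bar>\<close> large, which are negligible by (1)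
  and (2) (\<open>exists_orbit_near_targets\<close>). It remains to choose the sets \<open>E p\<close> with positive lower
  density for the given weights.

  The weights \<open>exp (k / ln k)\<close> concentrate the mass of \<open>{1..n}\<close> in a window of length of order
  \<open>ln n\<close> below \<open>n\<close>, but on such a window they vary only by a bounded factor. So
  for positive lower density it suffices to have a fixed positive proportion of each of
  the consecutive blocks, far enough out, of a subdivision whose blocks are at most
  logarithmically long
  (\<open>lower_density_pos_if_proportional\<close>). This leaves room for the separation, because the
  blocks may still get arbitrarily long: give about the
  proportion \<open>1 / 2 ^ Suc p\<close> of each block to \<open>E p\<close> as an interval, and let \<open>E p\<close> consist in it of a
  progression of step \<open>N p\<close> with margins \<open>N p\<close> at both ends. For fixed \<open>p\<close> the step and the margins
  cost only a constant factor once the blocks are long enough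
  (\<open>separated_set_gap\<close>, \<open>lower_density_separated_set_pos\<close>).
\<close>

section \<open>A criterion for positive lower density\<close>

lemma infsum_admissible_matrix_row:
  "(\<Sum>\<^sub>\<infinity>k\<in>{1..}. admissible_matrix \<alpha> n k * indicator E k) =
     (\<Sum>k\<in>E \<inter> {1..n}. \<alpha> k) / (\<Sum>k=1..n. \<alpha> k)"
proof -
  have "(\<Sum>\<^sub>\<infinity>k\<in>{1..}. admissible_matrix \<alpha> n k * indicator E k) =
     (\<Sum>\<^sub>\<infinity>k\<in>E \<inter> {1..n}. \<alpha> k / (\<Sum>k=1..n. \<alpha> k))"
    by (rule infsum_cong_neutral) (auto simp: admissible_matrix_def)
  also have "\<dots> = (\<Sum>k\<in>E \<inter> {1..n}. \<alpha> k) / (\<Sum>k=1..n. \<alpha> k)"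
    by (simp add: sum_divide_distrib)
  finally show ?thesis .
qed

lemma lower_density_mono:
  assumes "admissible_weights \<alpha>" "E \<subseteq> F"
  shows "lower_density (admissible_matrix \<alpha>) E \<le> lower_density (admissible_matrix \<alpha>) F"
  unfolding lower_density_def infsum_admissible_matrix_row
proof (intro Liminf_mono always_eventually allI)
  fix n
  have nn: "0 \<le> \<alpha> k" if "k \<in> {1..n}" for k
    using assms(1) that by (auto simp: admissible_weights_def)
  have "(\<Sum>k\<in>E \<inter> {1..n}. \<alpha> k) \<le> (\<Sum>k\<in>F \<inter> {1..n}. \<alpha> k)"
    using assms(2) nn by (intro sum_mono2) auto
  then show "ereal ((\<Sum>k\<in>E \<inter> {1..n}. \<alpha> k) / (\<Sum>k=1..n. \<alpha> k))
      \<le> ereal ((\<Sum>k\<in>F \<inter> {1..n}. \<alpha> k) / (\<Sum>k=1..n. \<alpha> k))"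
    using nn by (auto intro!: divide_right_mono sum_nonneg)
qed

lemma strict_mono_nat_between:
  fixes a :: "nat \<Rightarrow> nat"
  assumes "strict_mono a" "a i \<le> n"
  obtains m where "i \<le> m" "a m \<le> n" "n < a (Suc m)"
proof -
  have "\<exists>m\<ge>i. a m \<le> n \<and> n < a (Suc m)"
  proof -
    have fin: "finite {m. a m \<le> n}"
      by (rule finite_subset[of _ "{..n}"])
        (use strict_mono_imp_increasing[OF assms(1)] in \<open>auto intro: order_trans\<close>)
    have iin: "i \<in> {m. a m \<le> n}"
      using assms(2) by simp
    have "Max {m. a m \<le> n} \<in> {m. a m \<le> n}"
      using Max_in[OF fin] iin by blast
    moreover have "i \<le> Max {m. a m \<le> n}"
      using Max_ge[OF fin iin] .
    moreover have "\<not> a (Suc (Max {m. a m \<le> n})) \<le> n"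
      using Max_ge[OF fin, of "Suc (Max {m. a m \<le> n})"] by auto
    ultimately show ?thesis
      by (intro exI[of _ "Max {m. a m \<le> n}"]) auto
  qed
  then show ?thesis using that by blast
qed

text \<open>
  Cut the integers into blocks. If the part of \<open>E\<close> in each block outweighs, up to a constant
  factor, the whole following block, then summation gives the same comparison between
  \<open>E \<inter> {1..n}\<close> and \<open>{1..n}\<close>: the block that contains \<open>n\<close>, of which \<open>E\<close> may occupy only the part
  beyond \<open>n\<close>, is paid for by the preceding block. The initial blocks do not matter because the
  total weight diverges.
\<close>

lemma lower_density_pos_if_blocks:
  assumes adm: "admissible_weights \<alpha>"
    and a: "strict_mono a"
    and D: "D > 0"
    and blocks: "\<forall>\<^sub>F j in sequentially.
      (\<Sum>k\<in>{a (Suc j)..<a (Suc (Suc j))}. \<alpha> k) \<le> D * (\<Sum>k\<in>E \<inter> {a j..<a (Suc j)}. \<alpha> k)"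
  shows "lower_density (admissible_matrix \<alpha>) E > 0"
proof -
  have nn: "0 \<le> \<alpha> k" if "1 \<le> k" for k
    using adm that by (auto simp: admissible_weights_def)
  have mono: "a i \<le> a j" if "i \<le> j" for i j
    using that strict_mono_leD[OF a] by blast
  have "\<forall>\<^sub>F j in sequentially. 1 \<le> j \<and>
      (\<Sum>k\<in>{a (Suc j)..<a (Suc (Suc j))}. \<alpha> k) \<le> D * (\<Sum>k\<in>E \<inter> {a j..<a (Suc j)}. \<alpha> k)"
    using blocks eventually_ge_at_top[of 1] by eventually_elim auto
  then obtain J where J: "1 \<le> J"
    "\<And>j. j \<ge> J \<Longrightarrow>
      (\<Sum>k\<in>{a (Suc j)..<a (Suc (Suc j))}. \<alpha> k) \<le> D * (\<Sum>k\<in>E \<inter> {a j..<a (Suc j)}. \<alpha> k)"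
    unfolding eventually_sequentially by blast
  have aJ: "1 \<le> a J"
    using strict_mono_imp_increasing[OF a, of J] J(1) by linarith
  have tele: "(\<Sum>k\<in>{a (Suc J)..<a (Suc m)}. \<alpha> k) \<le> D * (\<Sum>k\<in>E \<inter> {a J..<a m}. \<alpha> k)"
    if "J \<le> m" for m
    using that
  proof (induction m rule: dec_induct)
    case base
    then show ?case by simp
  next
    case (step m)
    have "{a (Suc J)..<a (Suc (Suc m))} = {a (Suc J)..<a (Suc m)} \<union> {a (Suc m)..<a (Suc (Suc m))}"
      using mono[of "Suc J" "Suc m"] mono[of "Suc m" "Suc (Suc m)"] step by auto
    then have "(\<Sum>k\<in>{a (Suc J)..<a (Suc (Suc m))}. \<alpha> k) =
        (\<Sum>k\<in>{a (Suc J)..<a (Suc m)}. \<alpha> k) + (\<Sum>k\<in>{a (Suc m)..<a (Suc (Suc m))}. \<alpha> k)"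
      by (metis finite_atLeastLessThan ivl_disj_int_two(3) sum.union_disjoint)
    also have "\<dots> \<le> D * (\<Sum>k\<in>E \<inter> {a J..<a m}. \<alpha> k) + D * (\<Sum>k\<in>E \<inter> {a m..<a (Suc m)}. \<alpha> k)"
      using step J(2)[of m] by (intro add_mono) auto
    also have "\<dots> = D * (\<Sum>k\<in>(E \<inter> {a J..<a m}) \<union> (E \<inter> {a m..<a (Suc m)}). \<alpha> k)"
      by (subst sum.union_disjoint) (auto simp: distrib_left)
    also have "(E \<inter> {a J..<a m}) \<union> (E \<inter> {a m..<a (Suc m)}) = E \<inter> {a J..<a (Suc m)}"
      using mono[of J m] mono[of m "Suc m"] step by auto
    finally show ?case .
  qed
  define c where "c = (\<Sum>k\<in>{1..<a (Suc J)}. \<alpha> k)"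
  have total: "(\<Sum>k=1..n. \<alpha> k) \<le> c + D * (\<Sum>k\<in>E \<inter> {1..n}. \<alpha> k)" if n: "a (Suc J) \<le> n" for n
  proof -
    obtain m where m: "Suc J \<le> m" "a m \<le> n" "n < a (Suc m)"
      using strict_mono_nat_between[OF a n] by blast
    have "(\<Sum>k=1..n. \<alpha> k) \<le> (\<Sum>k\<in>{1..<a (Suc J)} \<union> {a (Suc J)..<a (Suc m)}. \<alpha> k)"
      using m nn aJ mono[of J "Suc J"] by (intro sum_mono2) auto
    also have "\<dots> = c + (\<Sum>k\<in>{a (Suc J)..<a (Suc m)}. \<alpha> k)"
      unfolding c_def by (subst sum.union_disjoint) auto
    also have "(\<Sum>k\<in>{a (Suc J)..<a (Suc m)}. \<alpha> k) \<le> D * (\<Sum>k\<in>E \<inter> {a J..<a m}. \<alpha> k)"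
      using tele[of m] m by auto
    also have "(\<Sum>k\<in>E \<inter> {a J..<a m}. \<alpha> k) \<le> (\<Sum>k\<in>E \<inter> {1..n}. \<alpha> k)"
      using m nn aJ by (intro sum_mono2) auto
    finally show ?thesis using D by simp
  qed
  have "filterlim (\<lambda>n. \<Sum>k=1..n. \<alpha> k) at_top sequentially"
    using adm by (simp add: admissible_weights_def)
  then have "\<forall>\<^sub>F n in sequentially. 2 * \<bar>c\<bar> + 1 \<le> (\<Sum>k=1..n. \<alpha> k)"
    by (simp add: filterlim_at_top)
  then have "\<forall>\<^sub>F n in sequentially.
      ereal (1 / (2 * D)) \<le> ereal ((\<Sum>k\<in>E \<inter> {1..n}. \<alpha> k) / (\<Sum>k=1..n. \<alpha> k))"
    using eventually_ge_at_top[of "a (Suc J)"]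
  proof eventually_elim
    case (elim n)
    let ?s = "\<Sum>k=1..n. \<alpha> k" and ?e = "\<Sum>k\<in>E \<inter> {1..n}. \<alpha> k"
    have "?s > 0" using elim(1) by linarith
    moreover have "?s \<le> 2 * D * ?e"
      using total[OF elim(2)] elim(1) by linarith
    ultimately show ?case
      using D by (simp add: field_simps)
  qed
  then have "ereal (1 / (2 * D)) \<le> lower_density (admissible_matrix \<alpha>) E"
    unfolding lower_density_def infsum_admissible_matrix_row by (rule Liminf_bounded)
  moreover have "0 < ereal (1 / (2 * D))" using D by simp
  ultimately show ?thesis by (rule less_le_trans[rotated])
qed

section \<open>Variation of the weights on windows of logarithmic length\<close>

text \<open>
  The exponent \<open>x / ln x\<close> is increasing beyond \<open>exp 1\<close> and its slope is at most \<open>1 / ln x\<close>. Both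
  bounds hold in the finite form used here without differentiation: the first is
  \<open>ln t \<le> t - 1\<close> for the quotient \<open>t\<close> of the larger by the smaller argument, the second compares both numerators over the smaller denominator.
\<close>

lemma x_over_ln_le:
  fixes x y d :: real
  assumes "3 \<le> x" "3 \<le> y" "x \<le> y + d * ln y" "0 \<le> d"
  shows "x / ln x \<le> y / ln y + d"
proof -
  have ln1: "1 \<le> ln z" if "3 \<le> z" for z :: real
    by (subst ln_ge_iff) (use that exp_le in linarith)+
  show ?thesis
  proof (cases "y \<le> x")
    case True
    have "x / ln x \<le> x / ln y"
      using True assms ln1[OF assms(2)] by (intro divide_left_mono) (auto intro!: mult_pos_pos)
    also have "\<dots> \<le> (y + d * ln y) / ln y"
      using assms ln1[OF assms(2)] by (intro divide_right_mono) auto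
    also have "\<dots> = y / ln y + d"
      using ln1[OF assms(2)] by (simp add: add_divide_distrib)
    finally show ?thesis .
  next
    case False
    have "ln y - ln x = ln (y / x)"
      using assms by (simp add: ln_div)
    also have "\<dots> \<le> y / x - 1"
      using assms by (intro ln_le_minus_one) simp
    also have "\<dots> \<le> (y / x - 1) * ln x"
      using False assms ln1[OF assms(1)] mult_left_mono[of 1 "ln x" "y / x - 1"]
      by (simp add: field_simps)
    finally have "ln y \<le> y / x * ln x"
      by (simp add: algebra_simps)
    then have "x * ln y \<le> y * ln x"
      using assms by (simp add: field_simps)
    then have "x / ln x \<le> y / ln y"
      using ln1[OF assms(1)] ln1[OF assms(2)] by (simp add: field_simps)
    then show ?thesis using assms by simp
  qed
qed

section \<open>Well separated sets of positive lower density\<close>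

text \<open>
  The block length grows to infinity, so that every block has room for any prescribed spacing,
  but not faster than the logarithm of the position, so that the weights are of constant order on
  two consecutive blocks. The offset 3 makes every block nonempty and keeps all positions
  beyond \<open>exp 1\<close>.
\<close>

definition block_len :: "nat \<Rightarrow> nat" where
  "block_len j = floor_log (j + 3)"

definition block_start :: "nat \<Rightarrow> nat" where
  "block_start j = 3 + (\<Sum>i<j. block_len i)"

lemma block_start_Suc: "block_start (Suc j) = block_start j + block_len j"
  by (simp add: block_start_def)

lemma block_len_pos: "1 \<le> block_len j"
  using floor_log_le_iff[of "2 ^ 1" "j + 3"] unfolding block_len_def floor_log_power by simp

lemma strict_mono_block_start: "strict_mono block_start"
  using block_len_pos by (auto simp: strict_mono_Suc_iff block_start_Suc Suc_le_eq)

lemma block_start_ge: "j + 3 \<le> block_start j"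
proof (induction j)
  case (Suc j)
  then show ?case using block_len_pos[of j] by (simp add: block_start_Suc)
qed (simp add: block_start_def)

lemma block_len_Suc: "block_len (Suc j) \<le> 2 * block_len j"
proof -
  have "floor_log (Suc j + 3) \<le> floor_log (2 * (j + 3))"
    by (rule floor_log_le_iff) simp
  also have "\<dots> = Suc (floor_log (j + 3))"
    by (rule floor_log_twice) simp
  finally show ?thesis
    using block_len_pos[of j] unfolding block_len_def by linarith
qed

lemma block_len_le_ln: "block_len j \<le> 2 * ln (real (block_start j))"
proof -
  have "2 ^ block_len j \<le> j + 3"
    unfolding block_len_def by (rule floor_log_exp2_le) simp
  then have "2 ^ block_len j \<le> block_start j"
    using block_start_ge[of j] by linarith
  then have "2 ^ block_len j \<le> real (block_start j)"
    by (metis of_nat_le_iff of_nat_numeral of_nat_power)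
  then have "ln (2 ^ block_len j) \<le> ln (real (block_start j))"
    by (subst ln_le_cancel_iff) (auto intro: less_le_trans[of 0 "2 ^ block_len j"])
  then have "block_len j * ln 2 \<le> ln (real (block_start j))"
    by (simp add: ln_realpow)
  moreover have "block_len j * (1/2) \<le> block_len j * ln (2::real)"
    using ln2_ge_two_thirds by (intro mult_left_mono) auto
  ultimately show ?thesis by linarith
qed

lemma filterlim_block_len: "filterlim block_len at_top sequentially"
  unfolding filterlim_at_top
proof
  fix Z
  have "Z \<le> block_len j" if "2 ^ Z \<le> j" for j
    using floor_log_le_iff[of "2 ^ Z" "j + 3"] that by (simp add: block_len_def)
  then show "\<forall>\<^sub>F j in sequentially. Z \<le> block_len j"
    using eventually_ge_at_top[of "2 ^ Z"] by (rule eventually_mono[rotated])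
qed

text \<open>
  Two consecutive blocks span at most three times the length of the first one, hence at most
  \<open>6 * ln (block_start j)\<close>. By the slope bound the weights there exceed the first one by a factor at
  most \<open>exp 6\<close>, so comparing weights reduces to counting elements.
\<close>

lemma lower_density_pos_if_proportional:
  fixes c :: real
  assumes B1: "B1_weights \<alpha>" and c: "0 < c"
    and proportion: "\<forall>\<^sub>F j in sequentially.
      c * block_len j \<le> card (E \<inter> {block_start j..<block_start (Suc j)})"
  shows "lower_density (admissible_matrix \<alpha>) E > 0"
proof (rule lower_density_pos_if_blocks[OF B1_weights_admissible[OF B1] strict_mono_block_start])
  show "0 < 2 * exp 6 / c" using c by simp
  obtain K where K: "\<And>k. k \<ge> K \<Longrightarrow> \<alpha> k = exp (real k / ln (real k))"
    using B1 by (auto simp: B1_weights_def eventually_sequentially)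
  show "\<forall>\<^sub>F j in sequentially.
      (\<Sum>k\<in>{block_start (Suc j)..<block_start (Suc (Suc j))}. \<alpha> k)
        \<le> 2 * exp 6 / c * (\<Sum>k\<in>E \<inter> {block_start j..<block_start (Suc j)}. \<alpha> k)"
    using proportion eventually_ge_at_top[of K]
  proof eventually_elim
    case (elim j)
    let ?a = block_start and ?L = block_len
    define \<mu> where "\<mu> = exp (real (?a j) / ln (real (?a j)))"
    have a3: "3 \<le> ?a j" and aK: "K \<le> ?a j"
      using block_start_ge[of j] elim(2) by linarith+
    have upper: "\<alpha> k \<le> exp 6 * \<mu>" if "k \<in> {?a (Suc j)..<?a (Suc (Suc j))}" for k
    proof -
      have "k \<le> ?a j + 3 * ?L j" "?a j \<le> k"
        using that block_len_Suc[of j] by (auto simp: block_start_Suc)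
      then have "real k \<le> real (?a j) + 6 * ln (real (?a j))" "?a j \<le> k"
        using block_len_le_ln[of j] by linarith+
      then have "real k / ln (real k) \<le> real (?a j) / ln (real (?a j)) + 6"
        using a3 by (intro x_over_ln_le) auto
      then show ?thesis
        using K[of k] aK \<open>?a j \<le> k\<close> by (simp add: \<mu>_def exp_add[symmetric] add.commute)
    qed
    have lower: "\<mu> \<le> \<alpha> k" if "k \<in> E \<inter> {?a j..<?a (Suc j)}" for k
    proof -
      have "?a j \<le> k" using that by simp
      then have "real (?a j) / ln (real (?a j)) \<le> real k / ln (real k) + 0"
        using a3 by (intro x_over_ln_le) auto
      then show ?thesis
        using K[of k] aK \<open>?a j \<le> k\<close> by (simp add: \<mu>_def)
    qed
    have "(\<Sum>k\<in>{?a (Suc j)..<?a (Suc (Suc j))}. \<alpha> k) \<le> ?L (Suc j) * (exp 6 * \<mu>)"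
    proof -
      have "(\<Sum>k\<in>{?a (Suc j)..<?a (Suc (Suc j))}. \<alpha> k)
          \<le> of_nat (card {?a (Suc j)..<?a (Suc (Suc j))}) * (exp 6 * \<mu>)"
        by (intro sum_bounded_above upper)
      then show ?thesis by (simp add: block_start_Suc)
    qed
    also have "\<dots> \<le> real (2 * ?L j) * (exp 6 * \<mu>)"
      using block_len_Suc[of j] by (intro mult_right_mono) (auto simp: \<mu>_def simp del: of_nat_mult)
    also have "\<dots> = 2 * exp 6 / c * ((c * ?L j) * \<mu>)"
      using c by simp
    also have "\<dots> \<le> 2 * exp 6 / c * (card (E \<inter> {?a j..<?a (Suc j)}) * \<mu>)"
      using c elim(1) by (intro mult_left_mono mult_right_mono) (auto simp: \<mu>_def)
    also have "\<dots> \<le> 2 * exp 6 / c * (\<Sum>k\<in>E \<inter> {?a j..<?a (Suc j)}. \<alpha> k)"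
      using c by (intro mult_left_mono sum_bounded_below lower) auto
    finally show ?case .
  qed
qed

text \<open>
  The block number \<open>j\<close> is cut at the points below into sub-blocks \<open>p = 0, 1, 2, \<dots>\<close>, which take
  about the proportions 1/2, 1/4, 1/8 and so on of the block; only finitely many of them are
  nonempty.
\<close>

definition cut :: "nat \<Rightarrow> nat \<Rightarrow> nat" where
  "cut j p = block_start j + (block_len j - block_len j div 2 ^ p)"

lemma cut_mono: "p \<le> q \<Longrightarrow> cut j p \<le> cut j q"
  unfolding cut_def by (intro add_left_mono diff_le_mono2 div_le_mono2) auto

lemma cut_bounds: "block_start j \<le> cut j p" "cut j p \<le> block_start (Suc j)"
  by (simp_all add: cut_def block_start_Suc del: Nat.add_diff_assoc)

text \<open>
  The \<open>p\<close>-th set is, in the \<open>p\<close>-th sub-block of each block, a progression of step \<open>N p\<close> that stays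
  \<open>N p\<close> away from both ends of the sub-block. The margins separate different sets from one another.
\<close>

definition separated_set :: "(nat \<Rightarrow> nat) \<Rightarrow> nat \<Rightarrow> nat set" where
  "separated_set N p = {n. \<exists>j i. 1 \<le> i \<and> n = cut j p + i * N p \<and> n + N p \<le> cut j (Suc p)}"

lemma separated_set_ge: "n \<in> separated_set N p \<Longrightarrow> N p \<le> n"
  by (force simp: separated_set_def Suc_le_eq intro: trans_le_add2)

lemma separated_set_gap:
  assumes n: "n \<in> separated_set N p" and m: "m \<in> separated_set N q" and ne: "n \<noteq> m \<or> p \<noteq> q"
  shows "n + max (N p) (N q) \<le> m \<or> m + max (N p) (N q) \<le> n"
proof -
  have lex: "n + max (N p) (N q) \<le> m"
    if "cut j p + N p \<le> n" "n + N p \<le> cut j (Suc p)"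
      "cut l q + N q \<le> m" "m + N q \<le> cut l (Suc q)" "j < l \<or> (j = l \<and> p < q)" for j l n m p q
  proof -
    have "cut j (Suc p) \<le> cut l q"
    proof (cases "j < l")
      case True
      have "cut j (Suc p) \<le> block_start (Suc j)" by (rule cut_bounds)
      also have "\<dots> \<le> block_start l"
        using True strict_mono_leD[OF strict_mono_block_start] by simp
      also have "\<dots> \<le> cut l q" by (rule cut_bounds)
      finally show ?thesis .
    next
      case False
      then show ?thesis using that(5) cut_mono by auto
    qed
    then show ?thesis using that by linarith
  qed
  obtain j i where ji: "1 \<le> i" "n = cut j p + i * N p" "n + N p \<le> cut j (Suc p)"
    using n by (auto simp: separated_set_def)
  obtain l h where lh: "1 \<le> h" "m = cut l q + h * N q" "m + N q \<le> cut l (Suc q)"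
    using m by (auto simp: separated_set_def)
  have lo: "cut j p + N p \<le> n" "cut l q + N q \<le> m"
    using ji lh by (auto simp: Suc_le_eq)
  consider "j < l \<or> (j = l \<and> p < q)" | "l < j \<or> (l = j \<and> q < p)" | "j = l" "p = q"
    by linarith
  then show ?thesis
  proof cases
    case 1
    then show ?thesis using lex[OF lo(1) ji(3) lo(2) lh(3)] by blast
  next
    case 2
    then show ?thesis using lex[OF lo(2) lh(3) lo(1) ji(3)] by (simp add: max.commute)
  next
    case 3
    then have "i < h \<or> h < i" using ne ji lh by auto
    then have "(i + 1) * N p \<le> h * N p \<or> (h + 1) * N p \<le> i * N p"
      by (metis Suc_eq_plus1 Suc_leI mult_le_mono1)
    then show ?thesis using 3 ji lh by auto
  qed
qed

text \<open>
  The sub-block has at least half the length \<open>block_len j div 2 ^ p\<close>. A progression of step \<open>N p\<close>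
  would fit about \<open>1 / N p\<close> of that many points; the margins and rounding lose at most two.
\<close>

lemma card_separated_set_block:
  assumes N: "1 \<le> N p"
  shows "real (block_len j) / 2 ^ p - 1 \<le>
    2 * N p * (card (separated_set N p \<inter> {block_start j..<block_start (Suc j)}) + 2)"
proof -
  define d where "d = block_len j div 2 ^ p"
  define s where "s = cut j (Suc p) - cut j p"
  have s: "2 * s \<ge> d" "cut j (Suc p) = cut j p + s"
  proof -
    have "block_len j div 2 ^ Suc p = d div 2" "d \<le> block_len j"
      by (simp_all add: d_def div_mult2_eq[symmetric] mult.commute)
    then have "cut j (Suc p) = cut j p + (d - d div 2)"
      by (simp add: cut_def d_def[symmetric])
    then show "2 * s \<ge> d" "cut j (Suc p) = cut j p + s"
      by (auto simp: s_def)
  qed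
  let ?A = "separated_set N p \<inter> {block_start j..<block_start (Suc j)}"
  let ?I = "{1..s div N p - 1}"
  have "(\<lambda>i. cut j p + i * N p) ` ?I \<subseteq> ?A"
  proof safe
    fix i assume i: "i \<in> ?I"
    then have "(i + 1) * N p \<le> s div N p * N p"
      by (intro mult_le_mono1) auto
    also have "\<dots> \<le> s"
      by (rule div_times_less_eq_dividend)
    finally have *: "cut j p + i * N p + N p \<le> cut j (Suc p)"
      using s(2) by simp
    then show "cut j p + i * N p \<in> separated_set N p"
      using i by (auto simp: separated_set_def)
    show "cut j p + i * N p \<in> {block_start j..<block_start (Suc j)}"
      using * cut_bounds[of j "Suc p"] cut_bounds[of j p] N by auto
  qed
  moreover have "inj_on (\<lambda>i. cut j p + i * N p) ?I"
    using N by (auto simp: inj_on_def)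
  ultimately have "card ?I \<le> card ?A"
    by (metis card_image card_mono finite_Int finite_atLeastLessThan)
  then have "s div N p + 1 \<le> card ?A + 2" by simp
  then have "N p * (s div N p + 1) \<le> N p * (card ?A + 2)"
    by (rule mult_le_mono2)
  moreover have "s \<le> N p * (s div N p + 1)"
    using N by (metis add.commute dividend_less_times_div less_imp_le mult_Suc_right
        Suc_eq_plus1 zero_less_one less_le_trans)
  ultimately have "d \<le> 2 * (N p * (card ?A + 2))"
    using s(1) by linarith
  then have "real d \<le> real (2 * (N p * (card ?A + 2)))"
    by (rule of_nat_mono)
  moreover have "real (block_len j) / 2 ^ p - 1 \<le> real d"
  proof -
    have "block_len j < 2 ^ p * (d + 1)"
      unfolding d_def by (metis Suc_eq_plus1 dividend_less_times_div mult_Suc_right add.commute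
          zero_less_numeral zero_less_power)
    then have "real (block_len j) < real (2 ^ p * (d + 1))"
      by (rule of_nat_less_iff[THEN iffD2])
    then show ?thesis by (simp add: field_simps)
  qed
  ultimately show ?thesis by (simp add: algebra_simps)
qed

lemma lower_density_separated_set_pos:
  assumes "B1_weights \<alpha>" and N: "1 \<le> N p"
  shows "lower_density (admissible_matrix \<alpha>) (separated_set N p) > 0"
proof -
  define c :: real where "c = 1 / (4 * N p * 2 ^ p)"
  have "0 < c" using N by (simp add: c_def)
  have "\<forall>\<^sub>F j in sequentially. 2 ^ p * (2 + 8 * N p) \<le> block_len j"
    using filterlim_block_len by (simp add: filterlim_at_top)
  then have "\<forall>\<^sub>F j in sequentially.
      c * block_len j \<le> card (separated_set N p \<inter> {block_start j..<block_start (Suc j)})"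
  proof eventually_elim
    case (elim j)
    let ?A = "separated_set N p \<inter> {block_start j..<block_start (Suc j)}"
    define t where "t = real (block_len j) / 2 ^ p"
    have "real (2 ^ p * (2 + 8 * N p)) \<le> real (block_len j)"
      using elim by (rule of_nat_mono)
    then have t: "2 + 8 * real (N p) \<le> t"
      by (simp add: t_def field_simps)
    have "t - 1 \<le> 2 * N p * (card ?A + 2)"
      using card_separated_set_block[of N p j] N by (simp add: t_def)
    then have "t \<le> 4 * N p * card ?A"
      using t by (simp add: algebra_simps)
    then have "t / (4 * N p) \<le> card ?A"
      using N by (simp add: field_simps)
    then show ?case
      by (simp add: c_def t_def mult.commute)
  qed
  with assms(1) \<open>0 < c\<close> show ?thesis
    by (rule lower_density_pos_if_proportional)
qed

section \<open>The distance to the origin in a Frechet space\<close>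

lemma dist_add_le:
  fixes a b c d :: "'a::frechet_space"
  shows "dist (a + b) (c + d) \<le> dist a c + dist b d"
proof -
  have "dist (a + b) (c + d) \<le> dist (a + b) (c + b) + dist (c + b) (c + d)"
    by (rule dist_triangle)
  also have "dist (c + b) (c + d) = dist b d"
    using dist_translation[of b c d] by (simp add: add.commute)
  finally show ?thesis by (simp add: dist_translation)
qed

lemma dist_add_left_zero:
  fixes a b :: "'a::frechet_space"
  shows "dist (a + b) a = dist b 0"
  using dist_translation[of b a 0] by (simp add: add.commute)

lemma dist_sum_zero_le:
  fixes f :: "'i \<Rightarrow> 'a::frechet_space"
  shows "dist (sum f A) 0 \<le> (\<Sum>i\<in>A. dist (f i) 0)"
proof (induction A rule: infinite_finite_induct)
  case (insert i A)
  then show ?case using dist_add_le[of "f i" "sum f A" 0 0] by simp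
qed auto

text \<open>
  The infinite sum of \<open>(1/2) ^ max p P\<close> over \<open>p\<close>. In all estimates below the \<open>p\<close>-th term is controlled
  by whichever of the thresholds for \<open>p\<close> and for \<open>P\<close> is stronger.
\<close>

definition total_error :: "nat \<Rightarrow> real" where
  "total_error P = (P + 2) * (1/2) ^ P"

lemma sum_half_power_max_le: "(\<Sum>p\<le>K. (1/2::real) ^ max p P) \<le> total_error P"
proof -
  have low: "(\<Sum>p\<le>K. (1/2::real) ^ max p P) \<le> (K + 1) * (1/2) ^ P" if "K \<le> P" for K
    using that by (simp add: max_absorb2)
  have high: "(\<Sum>p\<le>P + i. (1/2::real) ^ max p P) = total_error P - (1/2) ^ (P + i)" for i
  proof (induction i)
    case 0
    then show ?case by (simp add: max_absorb2 total_error_def algebra_simps)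
  qed simp
  show ?thesis
  proof (cases "K \<le> P")
    case True
    then show ?thesis
      using low[OF True] by (auto simp: total_error_def intro!: mult_right_mono elim!: order_trans)
  next
    case False
    then show ?thesis
      using high[of "K - P"] by simp
  qed
qed

lemma total_error_tendsto_0: "total_error \<longlonglongrightarrow> 0"
proof -
  have "(\<lambda>n. real n * (1/2) ^ n + 2 * (1/2) ^ n) \<longlonglongrightarrow> 0 + 2 * 0"
    by (intro tendsto_intros powser_times_n_limit_0 LIMSEQ_realpow_zero) auto
  then show ?thesis
    by (simp add: total_error_def[abs_def] algebra_simps)
qed

lemma dist_sum_le_total_error:
  fixes f :: "nat \<Rightarrow> 'a::frechet_space"
  assumes "\<And>p. dist (f p) 0 \<le> (1/2) ^ max p P"
  shows "dist (\<Sum>p\<le>K. f p) 0 \<le> total_error P"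
  by (rule order_trans[OF dist_sum_zero_le
        order_trans[OF sum_mono[OF assms] sum_half_power_max_le]])

section \<open>A vector whose orbit meets every target along a separated set\<close>

text \<open>
  The vector is \<open>x = (\<Sum>p. \<Sum>m\<in>E p. S m (y p))\<close>. Applying \<open>T n\<close> with \<open>n \<in> E P\<close>, the term
  \<open>m = n\<close> gives nearly \<open>y P\<close>. In the remaining terms for a given \<open>p\<close>, the indices \<open>m\<close> differ from
  \<open>n\<close> by at least \<open>N p\<close> and \<open>N P\<close>; so they contribute at most \<open>(1/2) ^ max p P\<close> from either side
  of \<open>n\<close>, and the sum over \<open>p\<close> is small for large \<open>P\<close>. Only finite partial sums are estimated; the
  estimates pass to the limit by continuity of \<open>T n\<close>.
\<close>

lemma exists_orbit_near_targets:
  fixes T :: "nat \<Rightarrow> 'a::frechet_space \<Rightarrow> 'b::frechet_space"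
    and S :: "nat \<Rightarrow> 'b \<Rightarrow> 'a" and y :: "nat \<Rightarrow> 'b"
    and N :: "nat \<Rightarrow> nat" and E :: "nat \<Rightarrow> nat set"
  assumes lin: "\<And>n. n \<ge> 1 \<Longrightarrow> linear (T n)"
    and cont: "\<And>n. n \<ge> 1 \<Longrightarrow> continuous_on UNIV (T n)"
    and past: "\<And>p q n F. p \<le> q \<Longrightarrow> n \<ge> 1 \<Longrightarrow> finite F \<Longrightarrow> F \<subseteq> {N q..} \<Longrightarrow>
      dist (\<Sum>j\<in>F. if j < n then T n (S (n - j) (y p)) else 0) 0 \<le> (1/2) ^ q"
    and future: "\<And>p q n F. p \<le> q \<Longrightarrow> n \<ge> 1 \<Longrightarrow> finite F \<Longrightarrow> F \<subseteq> {N q..} \<Longrightarrow>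
      dist (\<Sum>j\<in>F. T n (S (n + j) (y p))) 0 \<le> (1/2) ^ q"
    and series: "\<And>p q F. p \<le> q \<Longrightarrow> finite F \<Longrightarrow> F \<subseteq> {N q..} \<Longrightarrow>
      dist (\<Sum>m\<in>F. S m (y p)) 0 \<le> (1/2) ^ q"
    and diag: "\<And>p n. N p \<le> n \<Longrightarrow> dist (T n (S n (y p))) (y p) \<le> (1/2) ^ p"
    and N: "\<And>p. p < N p"
    and E_ge: "\<And>p n. n \<in> E p \<Longrightarrow> N p \<le> n"
    and E_gap: "\<And>p q n m. n \<in> E p \<Longrightarrow> m \<in> E q \<Longrightarrow> n \<noteq> m \<or> p \<noteq> q \<Longrightarrow>
      n + max (N p) (N q) \<le> m \<or> m + max (N p) (N q) \<le> n"
  shows "\<exists>x. \<forall>P. \<forall>n\<in>E P. dist (T n x) (y P) \<le> 3 * total_error P"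
proof -
  define X where "X K = (\<Sum>p\<le>K. \<Sum>m\<in>E p \<inter> {..K}. S m (y p))" for K
  have E_gt: "p < n" "1 \<le> n" if "n \<in> E p" for n p
    using E_ge[OF that] N[of p] by linarith+

  \<comment> \<open>For \<open>K < p\<close> the set \<open>E p\<close> has no element up to \<open>K\<close>, so both partial sums may be taken
    over the same range of \<open>p\<close>.\<close>
  have tail: "dist (X L) (X K) \<le> total_error Q" if "N Q \<le> K" "K \<le> L" for K L Q
  proof -
    have "E p \<inter> {..K} = {}" if "p \<in> {..L} - {..K}" for p
      using E_gt[of _ p] that by fastforce
    then have "X K = (\<Sum>p\<le>L. \<Sum>m\<in>E p \<inter> {..K}. S m (y p))"
      unfolding X_def using that by (intro sum.mono_neutral_left) auto
    moreover have "X L = (\<Sum>p\<le>L. (\<Sum>m\<in>E p \<inter> {..K}. S m (y p)) + (\<Sum>m\<in>E p \<inter> {K<..L}. S m (y p)))"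
      unfolding X_def using that
      by (intro sum.cong refl, subst sum.union_disjoint[symmetric]) (auto intro!: sum.cong)
    ultimately have "X L = X K + (\<Sum>p\<le>L. \<Sum>m\<in>E p \<inter> {K<..L}. S m (y p))"
      by (simp add: sum.distrib)
    then have "dist (X L) (X K) = dist (\<Sum>p\<le>L. \<Sum>m\<in>E p \<inter> {K<..L}. S m (y p)) 0"
      by (simp add: dist_add_left_zero)
    also have "\<dots> \<le> total_error Q"
    proof (rule dist_sum_le_total_error)
      fix p
      have "E p \<inter> {K<..L} \<subseteq> {N (max p Q)..}"
        using E_ge that by (force simp: max_def)
      then show "dist (\<Sum>m\<in>E p \<inter> {K<..L}. S m (y p)) 0 \<le> (1/2) ^ max p Q"
        by (intro series) auto
    qed
    finally show ?thesis .
  qed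

  have "Cauchy X"
  proof (rule metric_CauchyI)
    fix e :: real assume "0 < e"
    then have "\<forall>\<^sub>F Q in sequentially. total_error Q < e / 2"
      using order_tendstoD(2)[OF total_error_tendsto_0, of "e / 2"] by simp
    then obtain Q where Q: "total_error Q < e / 2"
      by (auto simp: eventually_sequentially)
    have "dist (X K) (X L) < e" if "N Q \<le> K" "N Q \<le> L" for K L
      using dist_triangle2[of "X K" "X L" "X (N Q)"] tail[OF order_refl that(1)]
        tail[OF order_refl that(2)] Q by linarith
    then show "\<exists>M. \<forall>m\<ge>M. \<forall>n\<ge>M. dist (X m) (X n) < e" by blast
  qed
  then obtain x where x: "X \<longlonglongrightarrow> x"
    using Cauchy_convergent convergent_def by blast

  have "dist (T n x) (y P) \<le> 3 * total_error P" if n: "n \<in> E P" for n P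
  proof (rule tendsto_upperbound)
    have n1: "1 \<le> n" using E_gt[OF n] by simp
    show "(\<lambda>K. dist (T n (X K)) (y P)) \<longlonglongrightarrow> dist (T n x) (y P)"
      by (intro tendsto_intros continuous_on_tendsto_compose[OF cont[OF n1] x]) auto
    have "dist (T n (X K)) (y P) \<le> 3 * total_error P" if K: "n \<le> K" for K
    proof -
      let ?t = "\<lambda>p m. T n (S m (y p))"
      let ?past = "\<lambda>p. \<Sum>m\<in>E p \<inter> {..<n}. ?t p m"
      let ?now = "\<lambda>p. \<Sum>m\<in>E p \<inter> {n}. ?t p m"
      let ?future = "\<lambda>p. \<Sum>m\<in>E p \<inter> {n<..K}. ?t p m"
      have N_max: "N (max p P) \<le> max (N P) (N p)" for p
        by (simp add: max_def)
      have only_P: "n \<notin> E p" if "p \<noteq> P" for p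
        using E_gap[OF n, of n p] that N[of p] by auto
      have "?now p = (if p = P then ?t P n else 0)" for p
      proof (cases "p = P")
        case False
        then have "E p \<inter> {n} = {}" using only_P by blast
        then show ?thesis using False by simp
      qed (use n in simp)
      then have "(\<Sum>p\<le>K. ?now p) = (\<Sum>p\<le>K. if p = P then ?t P n else 0)"
        by (intro sum.cong refl)
      also have "\<dots> = ?t P n"
        using K E_gt[OF n] by simp
      finally have now: "(\<Sum>p\<le>K. ?now p) = ?t P n" .
      have split: "(\<Sum>m\<in>E p \<inter> {..K}. ?t p m) = ?now p + ?past p + ?future p" for p
      proof -
        have "E p \<inter> {..K} = (E p \<inter> {n} \<union> E p \<inter> {..<n}) \<union> E p \<inter> {n<..K}"
          using K by auto
        moreover have "(\<Sum>m\<in>(E p \<inter> {n} \<union> E p \<inter> {..<n}) \<union> E p \<inter> {n<..K}. ?t p m)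
            = (\<Sum>m\<in>E p \<inter> {n} \<union> E p \<inter> {..<n}. ?t p m) + ?future p"
          by (rule sum.union_disjoint) auto
        moreover have "(\<Sum>m\<in>E p \<inter> {n} \<union> E p \<inter> {..<n}. ?t p m) = ?now p + ?past p"
          by (rule sum.union_disjoint) auto
        ultimately show ?thesis by simp
      qed
      have "T n (X K) = (\<Sum>p\<le>K. \<Sum>m\<in>E p \<inter> {..K}. ?t p m)"
        unfolding X_def by (simp add: linear_sum[OF lin[OF n1]])
      also have "\<dots> = ?t P n + ((\<Sum>p\<le>K. ?past p) + (\<Sum>p\<le>K. ?future p))"
        by (simp only: split sum.distrib now add.assoc)
      finally have decomp: "T n (X K) = ?t P n + ((\<Sum>p\<le>K. ?past p) + (\<Sum>p\<le>K. ?future p))" .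

      have "dist (\<Sum>p\<le>K. ?past p) 0 \<le> total_error P"
      proof (rule dist_sum_le_total_error)
        fix p
        let ?F = "(\<lambda>m. n - m) ` (E p \<inter> {..<n})"
        have "?past p = (\<Sum>j\<in>?F. if j < n then ?t p (n - j) else 0)"
        proof (subst sum.reindex)
          show "inj_on (\<lambda>m. n - m) (E p \<inter> {..<n})"
            by (auto simp: inj_on_def)
          have "0 < m" if "m \<in> E p" for m
            using E_gt[OF that] by simp
          then show "?past p = sum ((\<lambda>j. if j < n then ?t p (n - j) else 0) \<circ> (\<lambda>m. n - m))
              (E p \<inter> {..<n})"
            by (intro sum.cong) auto
        qed
        moreover have "N (max p P) \<le> n - m" if "m \<in> E p" "m < n" for m
          using E_gap[OF n that(1)] that(2) N_max[of p] by linarith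
        then have "?F \<subseteq> {N (max p P)..}" by auto
        ultimately show "dist (?past p) 0 \<le> (1/2) ^ max p P"
          using past[of p "max p P" n ?F] n1 by simp
      qed
      moreover have "dist (\<Sum>p\<le>K. ?future p) 0 \<le> total_error P"
      proof (rule dist_sum_le_total_error)
        fix p
        let ?F = "(\<lambda>m. m - n) ` (E p \<inter> {n<..K})"
        have "?future p = (\<Sum>j\<in>?F. ?t p (n + j))"
          by (subst sum.reindex) (auto simp: inj_on_def intro!: sum.cong)
        moreover have "N (max p P) \<le> m - n" if "m \<in> E p" "n < m" for m
          using E_gap[OF n that(1)] that(2) N_max[of p] by linarith
        then have "?F \<subseteq> {N (max p P)..}" by auto
        ultimately show "dist (?future p) 0 \<le> (1/2) ^ max p P"
          using future[of p "max p P" n ?F] n1 by simp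
      qed
      moreover have "dist (?t P n) (y P) \<le> total_error P"
      proof -
        have "(1/2) ^ P \<le> total_error P"
          by (simp add: total_error_def)
        then show ?thesis using diag[OF E_ge[OF n]] by linarith
      qed
      moreover have "dist (T n (X K)) (y P) \<le> dist (?t P n) (y P)
          + (dist (\<Sum>p\<le>K. ?past p) 0 + dist (\<Sum>p\<le>K. ?future p) 0)"
        unfolding decomp
        using dist_add_le[of "?t P n" "(\<Sum>p\<le>K. ?past p) + (\<Sum>p\<le>K. ?future p)" "y P" 0]
          dist_add_le[of "\<Sum>p\<le>K. ?past p" "\<Sum>p\<le>K. ?future p" 0 0] by simp
      ultimately show ?thesis by linarith
    qed
    then show "\<forall>\<^sub>F K in sequentially. dist (T n (X K)) (y P) \<le> 3 * total_error P"
      by (rule eventually_sequentiallyI)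
  qed simp
  then show ?thesis by blast
qed

section \<open>Choice of the targets and of the thresholds\<close>

lemma unif_uncond_convergent_eventually:
  fixes f :: "nat \<Rightarrow> nat \<Rightarrow> 'a::frechet_space"
  assumes "unif_uncond_convergent f" "0 < e"
  shows "\<forall>\<^sub>F R in sequentially. \<forall>k\<ge>1. \<forall>F. finite F \<and> F \<subseteq> {R..} \<longrightarrow> dist (\<Sum>n\<in>F. f n k) 0 \<le> e"
proof -
  have ball: "open (ball (0::'a) e) \<and> 0 \<in> ball (0::'a) e" using assms(2) by simp
  have tails: "\<forall>W. open W \<and> 0 \<in> W \<longrightarrow>
      (\<exists>R\<ge>1. \<forall>k\<ge>1. \<forall>F. finite F \<and> F \<subseteq> {R..} \<longrightarrow> (\<Sum>n\<in>F. f n k) \<in> W)"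
    using assms(1) unfolding unif_uncond_convergent_def by (rule conjunct2)
  have "\<exists>R\<ge>1. \<forall>k\<ge>1. \<forall>F. finite F \<and> F \<subseteq> {R..} \<longrightarrow> (\<Sum>n\<in>F. f n k) \<in> ball 0 e"
    by (rule mp[OF spec[OF tails] ball])
  then obtain R where R: "\<And>k F. k \<ge> 1 \<Longrightarrow> finite F \<Longrightarrow> F \<subseteq> {R..} \<Longrightarrow> (\<Sum>n\<in>F. f n k) \<in> ball 0 e"
    by blast
  show ?thesis
    unfolding eventually_sequentially
  proof (intro exI[of _ R] allI impI)
    fix R' k :: nat and F assume *: "R \<le> R'" "1 \<le> k" "finite F \<and> F \<subseteq> {R'..}"
    then have "F \<subseteq> {R..}" by auto
    then show "dist (\<Sum>n\<in>F. f n k) 0 \<le> e"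
      using R[of k F] * by (simp add: dist_commute)
  qed
qed

lemma summable_on_eventually_small_sums:
  fixes f :: "nat \<Rightarrow> 'a::frechet_space"
  assumes "f summable_on {1..}" "0 < e"
  shows "\<forall>\<^sub>F R in sequentially. \<forall>F. finite F \<and> F \<subseteq> {R..} \<longrightarrow> dist (\<Sum>n\<in>F. f n) 0 \<le> e"
proof -
  obtain s where "(sum f \<longlongrightarrow> s) (finite_subsets_at_top {1..})"
    using assms(1) by (auto simp: summable_on_def has_sum_def)
  then have "\<forall>\<^sub>F G in finite_subsets_at_top {1..}. dist (sum f G) s < e / 2"
    by (rule tendstoD) (use assms(2) in simp)
  then have "\<exists>G. finite G \<and> G \<subseteq> {1..} \<and>
      (\<forall>H. finite H \<and> G \<subseteq> H \<and> H \<subseteq> {1..} \<longrightarrow> dist (sum f H) s < e / 2)"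
    unfolding eventually_finite_subsets_at_top .
  then obtain G where G: "finite G" "G \<subseteq> {1..}"
    "\<And>H. finite H \<Longrightarrow> G \<subseteq> H \<Longrightarrow> H \<subseteq> {1..} \<Longrightarrow> dist (sum f H) s < e / 2"
    by auto
  show ?thesis
    unfolding eventually_sequentially
  proof (intro exI[of _ "Suc (Max (insert 0 G))"] allI impI)
    fix R F assume *: "Suc (Max (insert 0 G)) \<le> R" "finite F \<and> F \<subseteq> {R..}"
    have pos: "F \<subseteq> {1..}" using * by auto
    have "G \<inter> F = {}"
    proof (rule ccontr)
      assume "G \<inter> F \<noteq> {}"
      then obtain g where g: "g \<in> G" "g \<in> F" by auto
      then have "g \<le> Max (insert 0 G)" "R \<le> g" using G(1) * by auto
      then show False using *(1) by linarith
    qed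
    then have union: "sum f (G \<union> F) = sum f G + sum f F"
      using G(1) * by (intro sum.union_disjoint) auto
    have "dist (sum f F) 0 = dist (sum f (G \<union> F)) (sum f G)"
      by (simp add: union dist_add_left_zero)
    also have "\<dots> \<le> dist (sum f (G \<union> F)) s + dist (sum f G) s"
      by (rule dist_triangle2)
    also have "\<dots> \<le> e / 2 + e / 2"
      using G(1,2) * pos by (intro add_mono less_imp_le[OF G(3)]) auto
    also have "\<dots> = e" by simp
    finally show "dist (sum f F) 0 \<le> e" .
  qed
qed

text \<open>
  Every element of a countable dense subset of \<open>Y0\<close> is listed infinitely often, because the \<open>P\<close>-th
  target is only approximated with an error that tends to 0 as \<open>P\<close> grows.
\<close>

lemma dense_sequence_recurrent:
  fixes Y0 :: "'b::metric_space set"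
  assumes sep: "separable_space (euclidean :: 'b topology)" and dense: "closure Y0 = UNIV"
  shows "\<exists>y :: nat \<Rightarrow> 'b. (\<forall>p. y p \<in> Y0) \<and> (\<forall>z e b. 0 < e \<longrightarrow> (\<exists>p\<ge>b. dist (y p) z < e))"
proof -
  obtain C :: "'b set" where C: "countable C" "closure C = UNIV"
    using sep by (auto simp: separable_space_def)
  then have "C \<noteq> {}" by auto
  define c where "c = from_nat_into C"
  have c: "\<exists>i. dist (c i) z < e" if "0 < e" for z e
  proof -
    have "z \<in> closure C" using C(2) by simp
    then obtain w where "w \<in> C" "dist w z < e"
      using \<open>0 < e\<close> closure_approachable by blast
    then show ?thesis
      unfolding c_def using from_nat_into_surj[OF C(1), of w] by blast
  qed
  have "\<exists>w\<in>Y0. dist w (c i) < 1 / (real j + 1)" for i j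
  proof -
    have "c i \<in> closure Y0" using dense by simp
    moreover have "0 < 1 / (real j + 1)" by simp
    ultimately show ?thesis using closure_approachable by blast
  qed
  then have "\<exists>u. \<forall>i j. u i j \<in> Y0 \<and> dist (u i j) (c i) < 1 / (real j + 1)"
    by (intro choice allI) blast
  then obtain u where u: "\<And>i j. u i j \<in> Y0" "\<And>i j. dist (u i j) (c i) < 1 / (real j + 1)"
    by blast
  define y where "y p = (case prod_decode (fst (prod_decode p)) of (i, j) \<Rightarrow> u i j)" for p
  show ?thesis
  proof (intro exI[of _ y] conjI allI impI)
    show "y p \<in> Y0" for p
      by (simp add: y_def u split: prod.split)
    fix z :: 'b and e :: real and b assume "0 < e"
    obtain i where i: "dist (c i) z < e / 2" using c[of "e / 2" z] \<open>0 < e\<close> by auto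
    obtain j where j: "1 / (real j + 1) < e / 2"
      using nat_approx_posE[of "e / 2"] \<open>0 < e\<close> by (auto simp: add.commute)
    have "y (prod_encode (prod_encode (i, j), b)) = u i j"
      by (simp add: y_def)
    moreover have "dist (u i j) z < e"
      using dist_triangle[of "u i j" z "c i"] u(2)[of i j] i j by linarith
    ultimately show "\<exists>p\<ge>b. dist (y p) z < e"
      by (intro exI[of _ "prod_encode (prod_encode (i, j), b)"]) (simp add: le_prod_encode_2)
  qed
qed

section \<open>The frequent universality theorem\<close>

theorem proposition2p8:
  fixes T :: "nat \<Rightarrow> 'a::frechet_space \<Rightarrow> 'b::frechet_space"
    and S :: "nat \<Rightarrow> 'b \<Rightarrow> 'a"
    and Y0 :: "'b set"
    and \<alpha> :: "nat \<Rightarrow> real"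
  assumes "separable_space (euclidean :: 'b topology)"
    and "\<And>n. n \<ge> 1 \<Longrightarrow> linear (T n)"
    and "\<And>n. n \<ge> 1 \<Longrightarrow> continuous_on UNIV (T n)"
    and "closure Y0 = UNIV"
    and "\<And>y. y \<in> Y0 \<Longrightarrow>
           unif_uncond_convergent (\<lambda>n k. if n < k then T k (S (k - n) y) else 0)"
    and "\<And>y. y \<in> Y0 \<Longrightarrow> unif_uncond_convergent (\<lambda>n k. T k (S (k + n) y))"
    and "\<And>y. y \<in> Y0 \<Longrightarrow> (\<lambda>n. S n y) summable_on {1..}"
    and "\<And>y. y \<in> Y0 \<Longrightarrow> (\<lambda>n. T n (S n y)) \<longlonglongrightarrow> y"
    and "B1_weights \<alpha>"
  shows "frequently_universal (admissible_matrix \<alpha>) T"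
proof -
  obtain y :: "nat \<Rightarrow> 'b" where y: "\<And>p. y p \<in> Y0"
    and near: "\<And>z e b. 0 < e \<Longrightarrow> \<exists>p\<ge>b. dist (y p) z < e"
    using dense_sequence_recurrent[OF assms(1,4)] by (elim exE conjE) blast

  \<comment> \<open>The threshold \<open>N q\<close> must serve \<open>y 0, \<dots>, y q\<close> simultaneously: at \<open>n \<in> E q\<close> the series of the
    earlier targets contribute too, and their number grows with \<open>q\<close>.\<close>
  define tails_small where "tails_small p q R \<longleftrightarrow>
     (\<forall>k\<ge>1. \<forall>F. finite F \<and> F \<subseteq> {R..} \<longrightarrow>
        dist (\<Sum>j\<in>F. if j < k then T k (S (k - j) (y p)) else 0) 0 \<le> (1/2) ^ q) \<and>
     (\<forall>k\<ge>1. \<forall>F. finite F \<and> F \<subseteq> {R..} \<longrightarrow>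
        dist (\<Sum>j\<in>F. T k (S (k + j) (y p))) 0 \<le> (1/2) ^ q) \<and>
     (\<forall>F. finite F \<and> F \<subseteq> {R..} \<longrightarrow> dist (\<Sum>m\<in>F. S m (y p)) 0 \<le> (1/2) ^ q)" for p q R
  define good where "good q R \<longleftrightarrow> (\<forall>p\<in>{..q}. tails_small p q R) \<and>
     (\<forall>n\<ge>R. dist (T n (S n (y q))) (y q) \<le> (1/2) ^ q) \<and> q < R" for q R
  have "\<exists>R. good q R" for q
  proof -
    have pos: "0 < (1/2::real) ^ q" by simp
    have "\<forall>\<^sub>F R in sequentially. tails_small p q R" for p
      unfolding tails_small_def
      by (intro eventually_conj
          unif_uncond_convergent_eventually[OF assms(5)[OF y] pos]
          unif_uncond_convergent_eventually[OF assms(6)[OF y] pos]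
          summable_on_eventually_small_sums[OF assms(7)[OF y] pos])
    then have "\<forall>\<^sub>F R in sequentially. \<forall>p\<in>{..q}. tails_small p q R"
      by (intro eventually_ball_finite) auto
    moreover obtain M where M: "\<And>n. n \<ge> M \<Longrightarrow> dist (T n (S n (y q))) (y q) < (1/2) ^ q"
      using tendstoD[OF assms(8)[OF y] pos] by (auto simp: eventually_sequentially)
    have "\<forall>\<^sub>F R in sequentially. \<forall>n\<ge>R. dist (T n (S n (y q))) (y q) \<le> (1/2) ^ q"
      using eventually_ge_at_top[of M] by eventually_elim (use M in \<open>auto intro: less_imp_le\<close>)
    ultimately have "\<forall>\<^sub>F R in sequentially. good q R"
      unfolding good_def by (intro eventually_conj eventually_gt_at_top)
    then show ?thesis
      by (rule eventually_happens'[rotated]) simp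
  qed
  then obtain N where N: "\<And>q. good q (N q)"
    using choice[of good] by blast
  have N_gt: "p < N p" for p
    using N by (simp add: good_def)

  have "\<exists>x. \<forall>P. \<forall>n\<in>separated_set N P. dist (T n x) (y P) \<le> 3 * total_error P"
  proof (rule exists_orbit_near_targets[where T = T and S = S and y = y and N = N
        and E = "separated_set N"])
    show "dist (\<Sum>j\<in>F. if j < n then T n (S (n - j) (y p)) else 0) 0 \<le> (1/2) ^ q"
      if "p \<le> q" "n \<ge> 1" "finite F" "F \<subseteq> {N q..}" for p q n F
      using N[of q] that unfolding good_def tails_small_def by auto
    show "dist (\<Sum>j\<in>F. T n (S (n + j) (y p))) 0 \<le> (1/2) ^ q"
      if "p \<le> q" "n \<ge> 1" "finite F" "F \<subseteq> {N q..}" for p q n F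
      using N[of q] that unfolding good_def tails_small_def by auto
    show "dist (\<Sum>m\<in>F. S m (y p)) 0 \<le> (1/2) ^ q"
      if "p \<le> q" "finite F" "F \<subseteq> {N q..}" for p q F
      using N[of q] that unfolding good_def tails_small_def by auto
    show "dist (T n (S n (y p))) (y p) \<le> (1/2) ^ p" if "N p \<le> n" for p n
      using N[of p] that unfolding good_def by blast
  qed (use assms(2,3) N_gt separated_set_ge separated_set_gap in blast)+
  then obtain x where
    x: "\<And>P n. n \<in> separated_set N P \<Longrightarrow> dist (T n x) (y P) \<le> 3 * total_error P"
    by blast

  show ?thesis
    unfolding frequently_universal_def
  proof (intro exI[of _ x] allI impI)
    fix U :: "'b set" assume U: "open U \<and> U \<noteq> {}"
    then obtain z e where e: "0 < e" "ball z e \<subseteq> U"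
      by (metis all_not_in_conv open_contains_ball)
    have "\<forall>\<^sub>F p in sequentially. total_error p < e / 6"
      using order_tendstoD(2)[OF total_error_tendsto_0, of "e / 6"] e(1) by simp
    then obtain b where b: "\<And>p. p \<ge> b \<Longrightarrow> total_error p < e / 6"
      by (auto simp: eventually_sequentially)
    obtain p where p: "p \<ge> b" "dist (y p) z < e / 2"
      using near[of "e / 2" b z] e(1) by auto
    have "separated_set N p \<subseteq> visit_times T x U"
    proof
      fix n assume n: "n \<in> separated_set N p"
      have "dist z (T n x) < e"
        using dist_triangle[of "T n x" z "y p"] x[OF n] b[OF p(1)] p(2)
        by (simp add: dist_commute)
      moreover have "1 \<le> n"
        using separated_set_ge[OF n] N_gt[of p] by simp
      ultimately show "n \<in> visit_times T x U"
        using e(2) by (auto simp: visit_times_def)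
    qed
    then have "lower_density (admissible_matrix \<alpha>) (separated_set N p)
        \<le> lower_density (admissible_matrix \<alpha>) (visit_times T x U)"
      by (rule lower_density_mono[OF B1_weights_admissible[OF assms(9)]])
    moreover have "0 < lower_density (admissible_matrix \<alpha>) (separated_set N p)"
      using N_gt[of p] by (intro lower_density_separated_set_pos assms(9)) simp
    ultimately show "0 < lower_density (admissible_matrix \<alpha>) (visit_times T x U)"
      by (rule less_le_trans[rotated])
  qed
qed

end
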